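(* Let $v,k,l$ be positive integers with $\gcd(k,l)=1$. The Pythagorean triple $(3,4,5)$ has the reciprocal property $R(v,k,l)$ if and only if there is a non-negative integer $t$ such that $(v,k,l)$ belongs to one of the following six groups: Group 1: $v=1+12t$, $k=1+5t$, $l=1$; Group 2: $v=1+6t$, $k=2+5t$, $l=2$; Group 3: $v=1+4t$, $k=3+5t$, $l=3$; Group 4: $v=1+3t$, $k=4+5t$, $l=4$; Group 5: $v=1+2t$, $k=6+5t$, $l=6$; Group 6: $v=1+t$, $k=12+5t$, $l=12$.
   Context: A Pythagorean triple is a triple $(a,b,c)$ of positive integers with $a^2+b^2=c^2$ ($a,b$ are the leg lengths and $c$ the hypotenuse length of a right triangle). Let $h=ab/c$ be the altitude to the hypotenuse of this triangle. For positive integers $v,k,l$ with $\gcd(k,l)=1$, the triple $(a,b,c)$ is said to have the reciprocal property $R(v,k,l)$ if $$\frac1a+\frac1b+\frac{v}{h}=\frac{k}{l}.$$ *)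

theory Defs
  imports Complex_Main
begin

definition pythagorean_triple :: "nat \<Rightarrow> nat \<Rightarrow> nat \<Rightarrow> bool" where
  "pythagorean_triple a b c \<longleftrightarrow> 0 < a \<and> 0 < b \<and> 0 < c \<and> a\<^sup>2 + b\<^sup>2 = c\<^sup>2"

definition altitude :: "nat \<Rightarrow> nat \<Rightarrow> nat \<Rightarrow> real" where
  "altitude a b c = real a * real b / real c"

definition reciprocal_property ::
    "nat \<Rightarrow> nat \<Rightarrow> nat \<Rightarrow> nat \<Rightarrow> nat \<Rightarrow> nat \<Rightarrow> bool" where
  "reciprocal_property a b c v k l \<longleftrightarrow>
     pythagorean_triple a b c \<and> 0 < v \<and> 0 < k \<and> 0 < l \<and> coprime k l \<and>
     1 / real a + 1 / real b + real v / altitude a b c = real k / real l"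

end

theory Submission
  imports Defs
begin

text \<open>Clearing denominators turns the property into (7 + 5v) l = 12k over the naturals
  (\<open>reciprocal_property_3_4_5_iff\<close>). As k and l are coprime, l divides 12; write 12 =
  ml. Then 7 + 5v = mk, so 5(v - 1) is divisible by m; since 5 is coprime to m, v = 1 + mt, and
  hence k = l + 5t. The six divisors l of 12 give the six groups.\<close>

lemma reciprocal_property_3_4_5_iff:
  assumes "0 < v" and "0 < k" and "0 < l" and "coprime k l"
  shows "reciprocal_property 3 4 5 v k l \<longleftrightarrow> (7 + 5 * v) * l = 12 * k"
proof -
  \<comment> \<open>The altitude is 12/5, so all three terms have common denominator 12.\<close>
  have "1 / real 3 + 1 / real 4 + real v / altitude 3 4 5 = (7 + 5 * real v) / 12"
    by (simp add: altitude_def field_simps)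
  moreover have "pythagorean_triple 3 4 5"
    by (simp add: pythagorean_triple_def)
  ultimately have "reciprocal_property 3 4 5 v k l \<longleftrightarrow> (7 + 5 * real v) / 12 = real k / real l"
    using assms unfolding reciprocal_property_def by metis
  also have "\<dots> \<longleftrightarrow> (7 + 5 * real v) * real l = 12 * real k"
    using \<open>0 < l\<close> by (simp add: field_simps)
  also have "\<dots> \<longleftrightarrow> real ((7 + 5 * v) * l) = real (12 * k)"
    by simp
  also have "\<dots> \<longleftrightarrow> (7 + 5 * v) * l = 12 * k"
    by (rule of_nat_eq_iff)
  finally show ?thesis .
qed

lemma nat_dvd_12_cases:
  fixes l :: nat
  assumes "l dvd 12"
  shows "l \<in> {1, 2, 3, 4, 6, 12}"
proof -
  have "l \<le> 12"
    using assms by (simp add: dvd_imp_le)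
  then have "l \<in> {0, 1, 2, 3, 4, 5, 6, 7, 8, 9, 10, 11, 12}"
    unfolding insert_iff empty_iff by presburger
  with assms show ?thesis
    by auto
qed

theorem theorem5:
  fixes v k l :: nat
  assumes "0 < v" and "0 < k" and "0 < l" and "coprime k l"
  shows "reciprocal_property 3 4 5 v k l \<longleftrightarrow>
    (\<exists>t::nat.
       (v = 1 + 12 * t \<and> k = 1 + 5 * t \<and> l = 1) \<or>
       (v = 1 + 6 * t \<and> k = 2 + 5 * t \<and> l = 2) \<or>
       (v = 1 + 4 * t \<and> k = 3 + 5 * t \<and> l = 3) \<or>
       (v = 1 + 3 * t \<and> k = 4 + 5 * t \<and> l = 4) \<or>
       (v = 1 + 2 * t \<and> k = 6 + 5 * t \<and> l = 6) \<or>
       (v = 1 + t \<and> k = 12 + 5 * t \<and> l = 12))"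
    (is "_ \<longleftrightarrow> ?groups")
proof -
  have "?groups" if eq: "(7 + 5 * v) * l = 12 * k"
  proof -
    have "l dvd 12 * k"
      using eq by (metis dvd_triv_right)
    then have "l dvd 12"
      using \<open>coprime k l\<close> by (simp add: coprime_commute coprime_dvd_mult_left_iff)
    then have "l \<in> {1, 2, 3, 4, 6, 12}"
      by (rule nat_dvd_12_cases)
    then consider "l = 1" | "l = 2" | "l = 3" | "l = 4" | "l = 6" | "l = 12"
      by blast
    then show ?thesis
      \<comment> \<open>For each l the witness is t = (v - 1) / (12 / l); \<open>0 < v\<close> makes
        it non-negative.\<close>
      using eq \<open>0 < v\<close> by cases (simp, presburger)+
  qed
  \<comment> \<open>With ml = 12, v = 1 + mt and k = l + 5t, both sides equal 12l + 60t.\<close>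
  moreover have "(7 + 5 * v) * l = 12 * k" if "?groups"
    using that by auto
  ultimately show ?thesis
    using reciprocal_property_3_4_5_iff[OF assms] by blast
qed

end
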